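(* Let $\mathcal{X}\subseteq\mathbb{R}^d$ be closed and convex with $\sup_{x,y\in\mathcal{X}}\|x-y\|^2\le D^2$, and let $f$ be a (possibly non-differentiable) convex function on $\mathcal{X}$, bounded below, with $f^*=\inf_{x\in\mathcal{X}}f(x)$. Suppose the stochastic gradient oracle is unbiased and bounded by $G^2$. Run projected SGD with step decay step-size with $T>1$ iterations, decay factor $\alpha>1$, initial step-size $\eta_0>0$, inner-loop size $S=2T/\log_\alpha T$, outer-loop size $N=T/S=(\log_\alpha T)/2$, and $x_1^1\in\mathcal{X}$. Then $$\frac1S\sum_{i=1}^S\mathbb{E}[f(x_i^N)]-f^*\le A_2\frac{\ln T}{\sqrt T}+\frac{B_2}{\sqrt T},$$ where $A_2=D^2/(4\eta_0\alpha\ln\alpha)$ and $B_2=G^2\eta_0\alpha/2$. Moreover, for the final iterate, $$\mathbb{E}[f(x_S^N)]-f^*\le(A_2+B_2)\frac{\ln T}{\sqrt T}+\frac{(2+\ln 2)B_2}{\sqrt T}.$$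
   Context: $\|\cdot\|$ is the Euclidean norm, $\partial f(x)$ the subdifferential. $f$ is convex on $\mathcal{X}$ means $f(y)\ge f(x)+\langle g,y-x\rangle$ for all $x,y\in\mathcal{X}$ and $g\in\partial f(x)$. Stochastic gradient oracle: queried at $x\in\mathcal{X}$ it returns a random vector $\hat g$ which (conditionally on the past of the algorithm) satisfies $\mathbb{E}[\hat g]=g$ for some $g\in\partial f(x)$. It is bounded by $G^2$ ($G>0$ fixed) if for every input, $\mathbb{E}[\|\hat g\|^2]\le G^2$. Projected SGD with step decay step-size. Inputs: $x_1^1$, $\eta_0$, $\alpha>1$, $T$, $S$, $N=T/S$. For $t=1,\dots,N$: set $\eta_t=\eta_0/\alpha^{t-1}$; for $i=1,\dots,S$: query the oracle at $x_i^t$ to obtain $\hat g_i^t$ and set $x_{i+1}^t=\Pi_{\mathcal{X}}(x_i^t-\eta_t\hat g_i^t)$, where $\Pi_{\mathcal{X}}$ is the Euclidean projection onto $\mathcal{X}$; then set $x_1^{t+1}=x_{S+1}^t$. Standing convention: $S$ and $N$ are assumed to be (positive) integers. *)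

theory Defs
  imports "HOL-Probability.Probability"
begin

text \<open>
  Subdifferential of a function on \<open>X\<close> (values of \<open>f\<close> outside \<open>X\<close> are irrelevant), so the
  subgradient inequality is required at the points of \<open>X\<close> only. Every subgradient of an
  extension of \<open>f\<close> to a larger set lies in this set as well.
\<close>
definition subdifferential :: "'a::real_inner set \<Rightarrow> ('a \<Rightarrow> real) \<Rightarrow> 'a \<Rightarrow> 'a set" where
  "subdifferential X f x = {g. \<forall>y\<in>X. f y \<ge> f x + g \<bullet> (y - x)}"

text \<open>
  Families \<open>nat \<Rightarrow> nat \<Rightarrow> 'w \<Rightarrow> 'a\<close> are indexed by the outer iteration \<open>t = 1, \<dots>, N\<close> and the inner
  iteration \<open>i\<close>: \<open>x t i\<close> is the iterate \<open>x\<^sub>i\<^sup>t\<close> (\<open>1 \<le> i \<le> S + 1\<close>) and \<open>ghat t i\<close> the answer of the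
  oracle when queried at it (\<open>1 \<le> i \<le> S\<close>). Entries with other indices are unconstrained.
\<close>
definition step_decay_sgd ::
  "'w measure \<Rightarrow> 'a::euclidean_space set \<Rightarrow> 'a \<Rightarrow> real \<Rightarrow> real \<Rightarrow> nat \<Rightarrow> nat \<Rightarrow>
   (nat \<Rightarrow> nat \<Rightarrow> 'w \<Rightarrow> 'a) \<Rightarrow> (nat \<Rightarrow> nat \<Rightarrow> 'w \<Rightarrow> 'a) \<Rightarrow> bool" where
  "step_decay_sgd M X x11 \<eta>0 \<alpha> S N ghat x \<longleftrightarrow>
     (\<forall>\<omega>\<in>space M.
        x 1 1 \<omega> = x11 \<and>
        (\<forall>t\<in>{1..N}.
           (\<forall>i\<in>{1..S}. x t (i + 1) \<omega> =
              closest_point X (x t i \<omega> - (\<eta>0 / \<alpha> ^ (t - 1)) *\<^sub>R ghat t i \<omega>)) \<and>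
           x (t + 1) 1 \<omega> = x t (S + 1) \<omega>))"

text \<open>
  The past of the algorithm just before the query \<open>(t, i)\<close>: the sigma algebra generated by all
  earlier oracle answers. The iterate \<open>x t i\<close> is a function of these.
\<close>
definition sgd_past ::
  "'w measure \<Rightarrow> nat \<Rightarrow> (nat \<Rightarrow> nat \<Rightarrow> 'w \<Rightarrow> 'a::topological_space) \<Rightarrow> nat \<Rightarrow> nat \<Rightarrow> 'w measure" where
  "sgd_past M S ghat t i = sigma (space M)
     {ghat s j -` A \<inter> space M | s j A.
        A \<in> sets borel \<and> 1 \<le> s \<and> 1 \<le> j \<and> (s < t \<and> j \<le> S \<or> s = t \<and> j < i)}"

text \<open>Conditional expectation of a random vector, taken coordinatewise.\<close>
definition vec_cond_exp ::
  "'w measure \<Rightarrow> 'w measure \<Rightarrow> ('w \<Rightarrow> 'a::euclidean_space) \<Rightarrow> 'w \<Rightarrow> 'a" where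
  "vec_cond_exp M F Y \<omega> = (\<Sum>b\<in>Basis. real_cond_exp M F (\<lambda>\<omega>'. Y \<omega>' \<bullet> b) \<omega> *\<^sub>R b)"

text \<open>
  The oracle can be queried at every point of \<open>X\<close> and then answers with some subgradient in
  expectation, so the subdifferential is nonempty on all of \<open>X\<close>; the first conjunct records this.
  As a consequence \<open>f\<close> is lower semicontinuous on \<open>X\<close>, and for bounded \<open>X\<close> and a bounded oracle
  the \<open>f (x t i)\<close> are integrable random variables.
\<close>
definition unbiased_subgradient_oracle ::
  "'w measure \<Rightarrow> 'a::euclidean_space set \<Rightarrow> ('a \<Rightarrow> real) \<Rightarrow> nat \<Rightarrow> nat \<Rightarrow>
   (nat \<Rightarrow> nat \<Rightarrow> 'w \<Rightarrow> 'a) \<Rightarrow> (nat \<Rightarrow> nat \<Rightarrow> 'w \<Rightarrow> 'a) \<Rightarrow> bool" where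
  "unbiased_subgradient_oracle M X f S N x ghat \<longleftrightarrow>
     (\<forall>y\<in>X. subdifferential X f y \<noteq> {}) \<and>
     (\<forall>t\<in>{1..N}. \<forall>i\<in>{1..S}.
        integrable M (ghat t i) \<and>
        (AE \<omega> in M. vec_cond_exp M (sgd_past M S ghat t i) (ghat t i) \<omega>
                      \<in> subdifferential X f (x t i \<omega>)))"

text \<open>
  The bound uses the nonnegative conditional expectation because
  \<^const>\<open>real_cond_exp\<close> carries no information for a nonintegrable \<open>\<parallel>ghat t i\<parallel>\<^sup>2\<close>.
\<close>
definition oracle_bounded_by ::
  "'w measure \<Rightarrow> nat \<Rightarrow> nat \<Rightarrow> (nat \<Rightarrow> nat \<Rightarrow> 'w \<Rightarrow> 'a::euclidean_space) \<Rightarrow> real \<Rightarrow> bool" where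
  "oracle_bounded_by M S N ghat B \<longleftrightarrow>
     (\<forall>t\<in>{1..N}. \<forall>i\<in>{1..S}.
        AE \<omega> in M. nn_cond_exp M (sgd_past M S ghat t i)
                     (\<lambda>\<omega>'. ennreal ((norm (ghat t i \<omega>'))\<^sup>2)) \<omega> \<le> ennreal B)"

end

theory Submission
  imports Defs
begin

text \<open>
  Only the last outer iteration matters. There the step size is the constant
  \<open>c = \<eta>0 \<alpha> / sqrt T\<close>, and telescoping \<open>\<parallel>x\<^sub>i - z\<parallel>\<^sup>2\<close> from \<open>i = m\<close> to \<open>S\<close> against a point \<open>z\<close> known at
  time \<open>m\<close> bounds the suffix sums of \<open>E f(x\<^sub>i) - E f(z)\<close>. Taking \<open>m = 1\<close> and \<open>z\<close> fixed gives the
  average bound. Taking \<open>z = x\<^sub>m\<close>, where the initial distance vanishes, shows that dropping \<open>x\<^sub>m\<close>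
  from the average over \<open>{m..S}\<close> raises it by at most \<open>c G\<^sup>2 / (2 (S - m))\<close>; summing these
  increments yields the harmonic number, hence the logarithm, in the bound for the last iterate.
\<close>

section \<open>Suffix averages and harmonic numbers\<close>

text \<open>The hypothesis says that \<open>e m\<close> lies at most \<open>b\<close> below the mean
  over \<open>{m..S}\<close>. Induction on \<open>k\<close> lengthens the suffix
  \<open>{S-k..S}\<close> to the left; each added entry costs \<open>b / (k + 1)\<close>, and these
  costs add up to \<open>b * harm k\<close>.\<close>

lemma last_le_average_plus_harm:
  fixes e :: "nat \<Rightarrow> real"
  assumes suffix: "\<And>m. m \<in> {1..S} \<Longrightarrow> (\<Sum>i=m..S. e i) \<le> (real S + 1 - real m) * (e m + b)"
    and "S \<ge> 1"
  shows "e S \<le> (\<Sum>i=1..S. e i) / real S + b * harm (S - 1)"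
proof -
  have "e S \<le> (\<Sum>i=S-k..S. e i) / (real k + 1) + b * harm k" if "k < S" for k
    using that
  proof (induction k)
    case 0
    then show ?case by (simp add: harm_expand)
  next
    case (Suc k)
    define s where "s = (\<Sum>i=S-k..S. e i)"
    define u where "u = e (S - Suc k)"
    have sum_Suc: "(\<Sum>i=S-Suc k..S. e i) = u + s"
      using Suc.prems by (simp add: s_def u_def sum.atLeast_Suc_atMost Suc_diff_Suc)
    have "u + s \<le> (real k + 2) * (u + b)"
    proof -
      have "real S + 1 - real (S - Suc k) = real k + 2"
        using Suc.prems by (simp add: of_nat_diff)
      moreover have "S - Suc k \<in> {1..S}"
        using Suc.prems by auto
      ultimately show ?thesis
        using suffix[of "S - Suc k"] unfolding sum_Suc u_def[symmetric] by (simp only:)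
    qed
    moreover define q where "q = (u + s) / (real k + 2)"
    then have q: "u + s = q * (real k + 2)"
      by simp
    ultimately have "q * (real k + 2) \<le> (u + b) * (real k + 2)"
      by (simp only: mult.commute)
    then have "q \<le> u + b"
      by simp
    \<comment> \<open>Here \<open>q\<close> is the mean of the longer suffix. Removing its first
      entry \<open>u\<close>, which is at least \<open>q - b\<close>, leaves at most
      \<open>q * (k + 2) - (q - b)\<close>.\<close>
    with q have "s \<le> q * (real k + 1) + b"
      by (simp add: distrib_left)
    then have "s / (real k + 1) \<le> q + b / (real k + 1)"
      by (simp add: pos_divide_le_eq distrib_right)
    moreover have "e S \<le> s / (real k + 1) + b * harm k"
      using Suc by (simp add: s_def)
    moreover have "b * harm (Suc k) = b * harm k + b / (real k + 1)"
      by (simp add: harm_Suc distrib_left divide_inverse add.commute)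
    ultimately show ?case
      by (simp add: sum_Suc q_def add.commute)
  qed
  from this[of "S - 1"] show ?thesis
    using \<open>S \<ge> 1\<close> by (simp add: of_nat_diff)
qed

text \<open>The sequence \<open>harm n - ln n\<close> is decreasing and has the value 1 at
  \<open>n = 1\<close>.\<close>

lemma harm_le_one_plus_ln:
  assumes "n \<ge> 1"
  shows "harm n \<le> 1 + ln (real n)"
  using euler_mascheroni_sequence_decreasing[of 1 n] assms by (simp add: harm_expand)

section \<open>Measurability of subdifferentiable functions\<close>

text \<open>On \<open>X\<close> the function is the supremum of its affine minorants, so a sublevel
  set is an intersection of \<open>X\<close> with closed half-spaces.\<close>

lemma closed_sublevel_if_subdifferentiable:
  assumes "closed X" and "\<forall>y\<in>X. subdifferential X f y \<noteq> {}"
  shows "closed {y \<in> X. f y \<le> a}"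
proof -
  have "{y \<in> X. f y \<le> a} =
    X \<inter> (\<Inter>v\<in>X. \<Inter>g\<in>subdifferential X f v. {y. g \<bullet> y \<le> a - f v + g \<bullet> v})" (is "?L = ?R")
  proof
    show "?L \<subseteq> ?R"
    proof (intro subsetI IntI INT_I)
      fix y v g assume y: "y \<in> ?L" and g: "v \<in> X" "g \<in> subdifferential X f v"
      then have "f y \<ge> f v + g \<bullet> (y - v)"
        by (simp add: subdifferential_def)
      with y show "y \<in> {y. g \<bullet> y \<le> a - f v + g \<bullet> v}"
        by (simp add: inner_diff_right)
    qed simp
    show "?R \<subseteq> ?L"
    proof
      fix y assume y: "y \<in> ?R"
      then have "y \<in> X" by simp
      then obtain g where "g \<in> subdifferential X f y"
        using assms(2) by auto
      \<comment> \<open>The minorant taken at \<open>y\<close> itself is tight there, so its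
        half-space already forces \<open>f y \<le> a\<close>.\<close>
      with y have "y \<in> {w. g \<bullet> w \<le> a - f y + g \<bullet> y}"
        using \<open>y \<in> X\<close> by (simp only: Int_iff INT_iff)
      with \<open>y \<in> X\<close> show "y \<in> ?L" by simp
    qed
  qed
  also have "closed \<dots>"
    using assms(1) by (intro closed_Int closed_INT ballI closed_halfspace_le)
  finally show ?thesis .
qed

text \<open>A convex function may be discontinuous at the boundary of \<open>X\<close>; lower
  semicontinuity, in the form of closed sublevel sets, is enough for measurability.\<close>

lemma borel_measurable_if_subdifferentiable:
  assumes "closed X" and "\<forall>y\<in>X. subdifferential X f y \<noteq> {}"
    and h: "h \<in> borel_measurable L" and range: "\<And>\<omega>. \<omega> \<in> space L \<Longrightarrow> h \<omega> \<in> X"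
  shows "(\<lambda>\<omega>. f (h \<omega>)) \<in> borel_measurable L"
  unfolding borel_measurable_iff_le
proof
  fix a
  have "{\<omega> \<in> space L. f (h \<omega>) \<le> a} = h -` {y \<in> X. f y \<le> a} \<inter> space L"
    using range by auto
  also have "\<dots> \<in> sets L"
    by (rule measurable_sets[OF h])
       (rule borel_closed[OF closed_sublevel_if_subdifferentiable[OF assms(1,2)]])
  finally show "{\<omega> \<in> space L. f (h \<omega>) \<le> a} \<in> sets L" .
qed

section \<open>Conditional expectations of random vectors\<close>

lemma integrable_vec_cond_exp:
  assumes "sigma_finite_subalgebra M F" and "integrable M Y"
  shows "integrable M (vec_cond_exp M F Y)"
proof -
  interpret sigma_finite_subalgebra M F by fact
  show ?thesis
    unfolding vec_cond_exp_def using assms(2)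
    by (intro Bochner_Integration.integrable_sum integrable_scaleR_left real_cond_exp_int(1)
        integrable_inner_left) auto
qed

lemma integrable_inner_bounded:
  fixes u Y :: "'w \<Rightarrow> 'a::euclidean_space"
  assumes "integrable M Y" and "u \<in> borel_measurable M"
    and bound: "\<And>\<omega>. \<omega> \<in> space M \<Longrightarrow> norm (u \<omega>) \<le> C"
  shows "integrable M (\<lambda>\<omega>. u \<omega> \<bullet> Y \<omega>)"
proof (rule Bochner_Integration.integrable_bound)
  show "integrable M (\<lambda>\<omega>. C * norm (Y \<omega>))"
    using assms(1) by simp
  show "(\<lambda>\<omega>. u \<omega> \<bullet> Y \<omega>) \<in> borel_measurable M"
    using assms(2) borel_measurable_integrable[OF assms(1)] by measurable
  have "\<bar>u \<omega> \<bullet> Y \<omega>\<bar> \<le> \<bar>C * norm (Y \<omega>)\<bar>" if "\<omega> \<in> space M" for \<omega>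
    using Cauchy_Schwarz_ineq2[of "u \<omega>" "Y \<omega>"] mult_right_mono[OF bound[OF that] norm_ge_zero[of "Y \<omega>"]]
    by linarith
  then show "AE \<omega> in M. norm (u \<omega> \<bullet> Y \<omega>) \<le> norm (C * norm (Y \<omega>))"
    by (intro AE_I2) simp
qed

text \<open>This is the pull-out property, applied in each coordinate. The bound on \<open>u\<close>
  makes the coordinate products integrable, as the scalar version requires.\<close>

lemma integral_inner_vec_cond_exp:
  fixes u Y :: "'w \<Rightarrow> 'a::euclidean_space"
  assumes F: "sigma_finite_subalgebra M F" and Y: "integrable M Y"
    and u: "u \<in> borel_measurable F"
    and bound: "\<And>\<omega>. \<omega> \<in> space M \<Longrightarrow> norm (u \<omega>) \<le> C"
  shows "(\<integral>\<omega>. u \<omega> \<bullet> vec_cond_exp M F Y \<omega> \<partial>M) = (\<integral>\<omega>. u \<omega> \<bullet> Y \<omega> \<partial>M)"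
proof -
  interpret sigma_finite_subalgebra M F by fact
  have [measurable]: "u \<in> borel_measurable M" "Y \<in> borel_measurable M"
    using measurable_from_subalg[OF subalg u] Y by auto
  have prod_int: "integrable M (\<lambda>\<omega>. (u \<omega> \<bullet> b) * (Y \<omega> \<bullet> b))" if "b \<in> Basis" for b
  proof -
    \<comment> \<open>Writing the product as an inner product of \<open>Y\<close> with a bounded
      vector makes \<open>integrable_inner_bounded\<close> applicable.\<close>
    have "integrable M (\<lambda>\<omega>. ((u \<omega> \<bullet> b) *\<^sub>R b) \<bullet> Y \<omega>)"
    proof (rule integrable_inner_bounded[OF Y])
      show "norm ((u \<omega> \<bullet> b) *\<^sub>R b) \<le> C" if "\<omega> \<in> space M" for \<omega>
        using Basis_le_norm[OF \<open>b \<in> Basis\<close>, of "u \<omega>"] bound[OF that] \<open>b \<in> Basis\<close> by simp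
    qed measurable
    then show ?thesis by (simp add: inner_commute)
  qed
  have uF: "(\<lambda>\<omega>. u \<omega> \<bullet> b) \<in> borel_measurable F" for b
    using u by measurable
  have "(\<integral>\<omega>. u \<omega> \<bullet> vec_cond_exp M F Y \<omega> \<partial>M) =
      (\<integral>\<omega>. (\<Sum>b\<in>Basis. (u \<omega> \<bullet> b) * real_cond_exp M F (\<lambda>\<omega>'. Y \<omega>' \<bullet> b) \<omega>) \<partial>M)"
    by (simp add: vec_cond_exp_def inner_sum_right mult.commute)
  also have "\<dots> = (\<Sum>b\<in>Basis. \<integral>\<omega>. (u \<omega> \<bullet> b) * real_cond_exp M F (\<lambda>\<omega>'. Y \<omega>' \<bullet> b) \<omega> \<partial>M)"
    by (rule Bochner_Integration.integral_sum) (intro real_cond_exp_intg(1) prod_int uF, measurable)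
  also have "\<dots> = (\<Sum>b\<in>Basis. \<integral>\<omega>. (u \<omega> \<bullet> b) * (Y \<omega> \<bullet> b) \<partial>M)"
    by (intro sum.cong refl real_cond_exp_intg(2) prod_int uF) measurable
  also have "\<dots> = (\<integral>\<omega>. (\<Sum>b\<in>Basis. (u \<omega> \<bullet> b) * (Y \<omega> \<bullet> b)) \<partial>M)"
    by (rule Bochner_Integration.integral_sum[symmetric]) (rule prod_int)
  also have "\<dots> = (\<integral>\<omega>. u \<omega> \<bullet> Y \<omega> \<partial>M)"
    by (simp add: euclidean_inner[symmetric])
  finally show ?thesis .
qed

text \<open>The nonnegative conditional expectation preserves the nonnegative integral before
  integrability is known. Finiteness of that integral then gives integrability and the bound
  together.\<close>

lemma (in prob_space) second_moment_if_nn_cond_exp_le: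
  fixes Y :: "'a \<Rightarrow> 'b::euclidean_space"
  assumes F: "sigma_finite_subalgebra M F" and Y: "Y \<in> borel_measurable M" and "B \<ge> 0"
    and le: "AE \<omega> in M. nn_cond_exp M F (\<lambda>\<omega>'. ennreal ((norm (Y \<omega>'))\<^sup>2)) \<omega> \<le> ennreal B"
  shows "integrable M (\<lambda>\<omega>. (norm (Y \<omega>))\<^sup>2)" and "expectation (\<lambda>\<omega>. (norm (Y \<omega>))\<^sup>2) \<le> B"
proof -
  interpret F: sigma_finite_subalgebra M F by fact
  note [measurable] = Y
  have "(\<integral>\<^sup>+\<omega>. ennreal ((norm (Y \<omega>))\<^sup>2) \<partial>M) =
      (\<integral>\<^sup>+\<omega>. nn_cond_exp M F (\<lambda>\<omega>'. ennreal ((norm (Y \<omega>'))\<^sup>2)) \<omega> \<partial>M)"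
    using F.nn_cond_exp_intg[of "\<lambda>_. 1" "\<lambda>\<omega>'. ennreal ((norm (Y \<omega>'))\<^sup>2)"] by simp
  also have "\<dots> \<le> (\<integral>\<^sup>+\<omega>. ennreal B \<partial>M)"
    by (rule nn_integral_mono_AE[OF le])
  finally have *: "(\<integral>\<^sup>+\<omega>. ennreal ((norm (Y \<omega>))\<^sup>2) \<partial>M) \<le> ennreal B"
    by (simp add: emeasure_space_1)
  show int: "integrable M (\<lambda>\<omega>. (norm (Y \<omega>))\<^sup>2)"
    using * by (intro integrableI_bounded) (auto simp: le_less_trans)
  show "expectation (\<lambda>\<omega>. (norm (Y \<omega>))\<^sup>2) \<le> B"
    using * \<open>B \<ge> 0\<close> by (subst (asm) nn_integral_eq_integral[OF int]) auto
qed

section \<open>Projected SGD with a constant step size\<close>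

text \<open>This models one outer iteration in isolation. \<open>F i\<close> is the information
  available just before query \<open>i\<close>; the start \<open>y 1\<close> may be random, since it
  depends on earlier outer iterations.\<close>

locale projected_sgd = prob_space M
  for M :: "'w measure" +
  fixes X :: "'a::euclidean_space set" and f :: "'a \<Rightarrow> real"
    and F :: "nat \<Rightarrow> 'w measure" and y g :: "nat \<Rightarrow> 'w \<Rightarrow> 'a"
    and c D G :: real and S :: nat
  assumes closed_X: "closed X" and convex_X: "convex X"
    and diam: "\<And>u v. u \<in> X \<Longrightarrow> v \<in> X \<Longrightarrow> (norm (u - v))\<^sup>2 \<le> D\<^sup>2"
    and bdd_below_f: "bdd_below (f ` X)"
    and subdiff_nonempty: "\<forall>v\<in>X. subdifferential X f v \<noteq> {}"
    and c_pos: "c > 0"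
    and F_subalg: "\<And>i. subalgebra M (F i)"
    and F_mono: "\<And>i j. i \<le> j \<Longrightarrow> sets (F i) \<subseteq> sets (F j)"
    and y_in_X: "\<And>i \<omega>. i \<in> {1..S + 1} \<Longrightarrow> \<omega> \<in> space M \<Longrightarrow> y i \<omega> \<in> X"
    and y_adapted: "\<And>i. i \<in> {1..S + 1} \<Longrightarrow> y i \<in> borel_measurable (F i)"
    and y_Suc: "\<And>i \<omega>. i \<in> {1..S} \<Longrightarrow> \<omega> \<in> space M \<Longrightarrow>
      y (i + 1) \<omega> = closest_point X (y i \<omega> - c *\<^sub>R g i \<omega>)"
    and g_integrable: "\<And>i. i \<in> {1..S} \<Longrightarrow> integrable M (g i)"
    and g_unbiased: "\<And>i. i \<in> {1..S} \<Longrightarrow>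
      AE \<omega> in M. vec_cond_exp M (F i) (g i) \<omega> \<in> subdifferential X f (y i \<omega>)"
    and g_bounded: "\<And>i. i \<in> {1..S} \<Longrightarrow>
      AE \<omega> in M. nn_cond_exp M (F i) (\<lambda>\<omega>'. ennreal ((norm (g i \<omega>'))\<^sup>2)) \<omega> \<le> ennreal (G\<^sup>2)"
begin

lemma F_sigma_finite: "sigma_finite_subalgebra M (F i)"
  by (intro finite_measure_subalgebra_is_sigma_finite finite_measure_subalgebra.intro
      finite_measure_subalgebra_axioms.intro F_subalg finite_measure_axioms)

text \<open>The assumption on the diameter constrains only \<open>D\<^sup>2\<close>, hence the
  absolute value.\<close>

lemma norm_diff_le:
  assumes "u \<in> X" and "v \<in> X"
  shows "norm (u - v) \<le> \<bar>D\<bar>"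
  using diam[OF assms] by (simp add: abs_le_square_iff[symmetric])

lemma y_measurable: "i \<in> {1..S + 1} \<Longrightarrow> y i \<in> borel_measurable M"
  by (rule measurable_from_subalg[OF F_subalg y_adapted])

lemma g_second_moment:
  assumes "i \<in> {1..S}"
  shows "integrable M (\<lambda>\<omega>. (norm (g i \<omega>))\<^sup>2)" and "expectation (\<lambda>\<omega>. (norm (g i \<omega>))\<^sup>2) \<le> G\<^sup>2"
  using second_moment_if_nn_cond_exp_le[OF F_sigma_finite _ _ g_bounded[OF assms]]
    g_integrable[OF assms] by auto

lemma integrable_norm_diff_sq:
  assumes "i \<in> {1..S + 1}" and z: "z \<in> borel_measurable M"
    and z_in: "\<And>\<omega>. \<omega> \<in> space M \<Longrightarrow> z \<omega> \<in> X"
  shows "integrable M (\<lambda>\<omega>. (norm (y i \<omega> - z \<omega>))\<^sup>2)"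
proof (rule integrable_const_bound)
  show "AE \<omega> in M. norm ((norm (y i \<omega> - z \<omega>))\<^sup>2) \<le> D\<^sup>2"
    using diam y_in_X[OF assms(1)] z_in by (intro AE_I2) simp
  show "(\<lambda>\<omega>. (norm (y i \<omega> - z \<omega>))\<^sup>2) \<in> borel_measurable M"
    using y_measurable[OF assms(1)] z by measurable
qed

text \<open>
  The subgradient bound makes \<open>f (y i)\<close> integrable even though \<open>f\<close> may be unbounded above on \<open>X\<close>.
\<close>
lemma integrable_f_y:
  assumes i: "i \<in> {1..S}"
  shows "integrable M (\<lambda>\<omega>. f (y i \<omega>))"
proof -
  obtain u where u: "u \<in> X"
    using not_empty y_in_X[of i] i by fastforce
  obtain l where l: "\<And>v. v \<in> X \<Longrightarrow> l \<le> f v"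
    using bdd_below_f unfolding bdd_below_def by blast
  let ?h = "vec_cond_exp M (F i) (g i)"
  \<comment> \<open>The subgradient at \<open>y i\<close>, tested against the fixed point
    \<open>u\<close>, bounds \<open>f (y i)\<close> above; the constant \<open>l\<close> bounds it
    below.\<close>
  let ?b = "\<lambda>\<omega>. \<bar>l\<bar> + (\<bar>f u\<bar> + norm (?h \<omega>) * \<bar>D\<bar>)"
  show ?thesis
  proof (rule Bochner_Integration.integrable_bound)
    show "integrable M ?b"
      using integrable_vec_cond_exp[OF F_sigma_finite g_integrable[OF i]]
      by (intro Bochner_Integration.integrable_add integrable_mult_left integrable_norm) auto
    show "(\<lambda>\<omega>. f (y i \<omega>)) \<in> borel_measurable M"
      by (rule borel_measurable_if_subdifferentiable[OF closed_X subdiff_nonempty])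
         (use i y_measurable y_in_X in auto)
    show "AE \<omega> in M. norm (f (y i \<omega>)) \<le> norm (?b \<omega>)"
      using g_unbiased[OF i] AE_space
    proof eventually_elim
      case (elim \<omega>)
      have yX: "y i \<omega> \<in> X" using y_in_X i elim by simp
      have "f u \<ge> f (y i \<omega>) + ?h \<omega> \<bullet> (u - y i \<omega>)"
        using elim u by (simp add: subdifferential_def)
      moreover have "\<bar>?h \<omega> \<bullet> (u - y i \<omega>)\<bar> \<le> norm (?h \<omega>) * \<bar>D\<bar>"
        using Cauchy_Schwarz_ineq2[of "?h \<omega>" "u - y i \<omega>"]
          mult_left_mono[OF norm_diff_le[OF u yX], of "norm (?h \<omega>)"] by simp
      moreover have "l \<le> f (y i \<omega>)" using l yX by simp
      ultimately show ?case by simp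
    qed
  qed
qed

text \<open>The subgradient inequality holds for the conditional mean of \<open>g i\<close>. As
  \<open>y i - z\<close> is known before query \<open>i\<close>, that mean can be replaced by
  \<open>g i\<close> under the expectation. A random \<open>z\<close> is allowed so that an earlier
  iterate can serve as comparison point.\<close>

lemma expected_gap_le_inner:
  assumes i: "i \<in> {1..S}" and z: "z \<in> borel_measurable (F i)"
    and z_in: "\<And>\<omega>. \<omega> \<in> space M \<Longrightarrow> z \<omega> \<in> X" and fz: "integrable M (\<lambda>\<omega>. f (z \<omega>))"
  shows "integrable M (\<lambda>\<omega>. (y i \<omega> - z \<omega>) \<bullet> g i \<omega>)"
    and "expectation (\<lambda>\<omega>. f (y i \<omega>)) - expectation (\<lambda>\<omega>. f (z \<omega>))
      \<le> expectation (\<lambda>\<omega>. (y i \<omega> - z \<omega>) \<bullet> g i \<omega>)"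
proof -
  let ?h = "vec_cond_exp M (F i) (g i)"
  have F_meas: "(\<lambda>\<omega>. y i \<omega> - z \<omega>) \<in> borel_measurable (F i)"
    using y_adapted i z by simp
  then have M_meas: "(\<lambda>\<omega>. y i \<omega> - z \<omega>) \<in> borel_measurable M"
    by (rule measurable_from_subalg[OF F_subalg])
  have bound: "norm (y i \<omega> - z \<omega>) \<le> \<bar>D\<bar>" if "\<omega> \<in> space M" for \<omega>
    using norm_diff_le y_in_X z_in i that by simp
  show "integrable M (\<lambda>\<omega>. (y i \<omega> - z \<omega>) \<bullet> g i \<omega>)"
    by (rule integrable_inner_bounded[OF g_integrable[OF i] M_meas bound])
  have "expectation (\<lambda>\<omega>. f (y i \<omega>) - f (z \<omega>)) \<le> expectation (\<lambda>\<omega>. (y i \<omega> - z \<omega>) \<bullet> ?h \<omega>)"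
  proof (rule integral_mono_AE)
    show "integrable M (\<lambda>\<omega>. f (y i \<omega>) - f (z \<omega>))"
      using integrable_f_y[OF i] fz by simp
    show "integrable M (\<lambda>\<omega>. (y i \<omega> - z \<omega>) \<bullet> ?h \<omega>)"
      by (rule integrable_inner_bounded[OF integrable_vec_cond_exp[OF F_sigma_finite
            g_integrable[OF i]] M_meas bound])
    show "AE \<omega> in M. f (y i \<omega>) - f (z \<omega>) \<le> (y i \<omega> - z \<omega>) \<bullet> ?h \<omega>"
      using g_unbiased[OF i] AE_space
    proof eventually_elim
      case (elim \<omega>)
      then have "f (z \<omega>) \<ge> f (y i \<omega>) + ?h \<omega> \<bullet> (z \<omega> - y i \<omega>)"
        using z_in by (simp add: subdifferential_def)
      then show ?case by (simp add: inner_diff inner_commute)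
    qed
  qed
  also have "\<dots> = expectation (\<lambda>\<omega>. (y i \<omega> - z \<omega>) \<bullet> g i \<omega>)"
    by (rule integral_inner_vec_cond_exp[OF F_sigma_finite g_integrable[OF i] F_meas bound])
  finally show "expectation (\<lambda>\<omega>. f (y i \<omega>)) - expectation (\<lambda>\<omega>. f (z \<omega>))
      \<le> expectation (\<lambda>\<omega>. (y i \<omega> - z \<omega>) \<bullet> g i \<omega>)"
    using integrable_f_y[OF i] fz by simp
qed

text \<open>Projection onto \<open>X\<close> is nonexpansive and fixes \<open>v\<close>; the rest is
  the expansion of a square.\<close>

lemma norm_step_le:
  assumes i: "i \<in> {1..S}" and "\<omega> \<in> space M" and "v \<in> X"
  shows "(norm (y (i + 1) \<omega> - v))\<^sup>2
    \<le> (norm (y i \<omega> - v))\<^sup>2 - 2 * c * ((y i \<omega> - v) \<bullet> g i \<omega>) + c\<^sup>2 * (norm (g i \<omega>))\<^sup>2"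
proof -
  have "norm (y (i + 1) \<omega> - v) \<le> norm (y i \<omega> - c *\<^sub>R g i \<omega> - v)"
    using closest_point_lipschitz[OF convex_X closed_X, of "y i \<omega> - c *\<^sub>R g i \<omega>" v] assms y_Suc
    by (auto simp: dist_norm closest_point_self)
  then have "(norm (y (i + 1) \<omega> - v))\<^sup>2 \<le> (norm (y i \<omega> - c *\<^sub>R g i \<omega> - v))\<^sup>2"
    by (simp add: power_mono)
  also have "\<dots> = (norm ((y i \<omega> - v) - c *\<^sub>R g i \<omega>))\<^sup>2"
    by (simp add: algebra_simps)
  also have "\<dots> = (norm (y i \<omega> - v))\<^sup>2 - 2 * c * ((y i \<omega> - v) \<bullet> g i \<omega>) + c\<^sup>2 * (norm (g i \<omega>))\<^sup>2"
    unfolding power2_norm_eq_inner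
    by (simp add: inner_diff inner_commute power2_eq_square algebra_simps)
  finally show ?thesis .
qed

lemma expected_step:
  assumes i: "i \<in> {1..S}" and z: "z \<in> borel_measurable (F i)"
    and z_in: "\<And>\<omega>. \<omega> \<in> space M \<Longrightarrow> z \<omega> \<in> X" and fz: "integrable M (\<lambda>\<omega>. f (z \<omega>))"
  shows "2 * c * (expectation (\<lambda>\<omega>. f (y i \<omega>)) - expectation (\<lambda>\<omega>. f (z \<omega>)))
    \<le> expectation (\<lambda>\<omega>. (norm (y i \<omega> - z \<omega>))\<^sup>2)
      - expectation (\<lambda>\<omega>. (norm (y (i + 1) \<omega> - z \<omega>))\<^sup>2) + c\<^sup>2 * G\<^sup>2"
proof -
  note zM = measurable_from_subalg[OF F_subalg z]
  note inner = expected_gap_le_inner[OF assms]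
  note moment = g_second_moment[OF i]
  have dist_i: "integrable M (\<lambda>\<omega>. (norm (y i \<omega> - z \<omega>))\<^sup>2)"
    using i by (intro integrable_norm_diff_sq zM z_in) auto
  have dist_Suc: "integrable M (\<lambda>\<omega>. (norm (y (i + 1) \<omega> - z \<omega>))\<^sup>2)"
    using i by (intro integrable_norm_diff_sq zM z_in) auto
  have "expectation (\<lambda>\<omega>. (norm (y (i + 1) \<omega> - z \<omega>))\<^sup>2)
      \<le> expectation (\<lambda>\<omega>. (norm (y i \<omega> - z \<omega>))\<^sup>2 - 2 * c * ((y i \<omega> - z \<omega>) \<bullet> g i \<omega>)
          + c\<^sup>2 * (norm (g i \<omega>))\<^sup>2)"
    by (intro integral_mono dist_Suc Bochner_Integration.integrable_add
        Bochner_Integration.integrable_diff dist_i integrable_mult_right inner(1) moment(1)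
        norm_step_le i z_in)
  also have "\<dots> = expectation (\<lambda>\<omega>. (norm (y i \<omega> - z \<omega>))\<^sup>2)
      - 2 * c * expectation (\<lambda>\<omega>. (y i \<omega> - z \<omega>) \<bullet> g i \<omega>)
      + c\<^sup>2 * expectation (\<lambda>\<omega>. (norm (g i \<omega>))\<^sup>2)"
    using dist_i inner(1) moment(1) by simp
  finally have "2 * c * expectation (\<lambda>\<omega>. (y i \<omega> - z \<omega>) \<bullet> g i \<omega>)
      \<le> expectation (\<lambda>\<omega>. (norm (y i \<omega> - z \<omega>))\<^sup>2)
        - expectation (\<lambda>\<omega>. (norm (y (i + 1) \<omega> - z \<omega>))\<^sup>2)
        + c\<^sup>2 * expectation (\<lambda>\<omega>. (norm (g i \<omega>))\<^sup>2)"
    by linarith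
  moreover have "c\<^sup>2 * expectation (\<lambda>\<omega>. (norm (g i \<omega>))\<^sup>2) \<le> c\<^sup>2 * G\<^sup>2"
    using moment(2) by (simp add: mult_left_mono)
  moreover have "2 * c * (expectation (\<lambda>\<omega>. f (y i \<omega>)) - expectation (\<lambda>\<omega>. f (z \<omega>)))
      \<le> 2 * c * expectation (\<lambda>\<omega>. (y i \<omega> - z \<omega>) \<bullet> g i \<omega>)"
    using inner(2) c_pos by (intro mult_left_mono) auto
  ultimately show ?thesis by linarith
qed

lemma suffix_bound:
  assumes m: "m \<in> {1..S}" and z: "z \<in> borel_measurable (F m)"
    and z_in: "\<And>\<omega>. \<omega> \<in> space M \<Longrightarrow> z \<omega> \<in> X" and fz: "integrable M (\<lambda>\<omega>. f (z \<omega>))"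
  shows "(\<Sum>i=m..S. expectation (\<lambda>\<omega>. f (y i \<omega>)) - expectation (\<lambda>\<omega>. f (z \<omega>)))
    \<le> expectation (\<lambda>\<omega>. (norm (y m \<omega> - z \<omega>))\<^sup>2) / (2 * c) + (real S + 1 - real m) * (c * G\<^sup>2 / 2)"
proof -
  let ?d = "\<lambda>i. expectation (\<lambda>\<omega>. (norm (y i \<omega> - z \<omega>))\<^sup>2)"
  let ?e = "\<lambda>i. expectation (\<lambda>\<omega>. f (y i \<omega>)) - expectation (\<lambda>\<omega>. f (z \<omega>))"
  have step: "2 * c * ?e i \<le> (?d i - ?d (Suc i)) + c\<^sup>2 * G\<^sup>2" if "i \<in> {m..S}" for i
  proof -
    \<comment> \<open>What is known at time \<open>m\<close> stays known later, so the same
      \<open>z\<close> may be used in every step from \<open>m\<close> on.\<close>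
    have "z \<in> borel_measurable (F i)"
      using measurable_mono[of borel borel "F m" "F i"] F_mono[of m i] F_subalg z that
      by (auto simp: subalgebra_def)
    then show ?thesis
      using expected_step[of i z] z_in fz that m by simp
  qed
  have "2 * c * (\<Sum>i=m..S. ?e i) = (\<Sum>i=m..S. 2 * c * ?e i)"
    by (simp add: sum_distrib_left)
  also have "\<dots> \<le> (\<Sum>i=m..S. (?d i - ?d (Suc i)) + c\<^sup>2 * G\<^sup>2)"
    by (rule sum_mono) (rule step)
  also have "\<dots> = ?d m - ?d (Suc S) + (real S + 1 - real m) * (c\<^sup>2 * G\<^sup>2)"
    using m sum_Suc_diff[of m S ?d]
    by (simp add: sum.distrib sum_subtractf of_nat_diff algebra_simps)
  \<comment> \<open>The distance after the last step is nonnegative and is dropped.\<close>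
  also have "\<dots> \<le> ?d m + (real S + 1 - real m) * (c\<^sup>2 * G\<^sup>2)"
    by simp
  finally show ?thesis
    using c_pos by (simp add: field_simps power2_eq_square)
qed

lemma average_bound:
  assumes "S \<ge> 1" and u: "u \<in> X"
  shows "(\<Sum>i=1..S. expectation (\<lambda>\<omega>. f (y i \<omega>))) / real S
    \<le> f u + D\<^sup>2 / (2 * c * real S) + c * G\<^sup>2 / 2"
proof -
  \<comment> \<open>The starting point may be anywhere in \<open>X\<close>, so only the diameter
    bounds the initial distance.\<close>
  have "expectation (\<lambda>\<omega>. (norm (y 1 \<omega> - u))\<^sup>2) \<le> expectation (\<lambda>_. D\<^sup>2)"
    using \<open>S \<ge> 1\<close> u diam y_in_X by (intro integral_mono integrable_norm_diff_sq) auto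
  then have "expectation (\<lambda>\<omega>. (norm (y 1 \<omega> - u))\<^sup>2) / (2 * c) \<le> D\<^sup>2 / (2 * c)"
    using c_pos by (simp add: divide_right_mono prob_space)
  with suffix_bound[of 1 "\<lambda>_. u"] \<open>S \<ge> 1\<close> u
  have "(\<Sum>i=1..S. expectation (\<lambda>\<omega>. f (y i \<omega>)))
      \<le> real S * f u + D\<^sup>2 / (2 * c) + real S * (c * G\<^sup>2 / 2)"
    by (simp add: sum_subtractf prob_space)
  then have "(\<Sum>i=1..S. expectation (\<lambda>\<omega>. f (y i \<omega>))) / real S
      \<le> (real S * f u + D\<^sup>2 / (2 * c) + real S * (c * G\<^sup>2 / 2)) / real S"
    by (simp add: divide_right_mono)
  also have "\<dots> = f u + D\<^sup>2 / (2 * c * real S) + c * G\<^sup>2 / 2"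
    using \<open>S \<ge> 1\<close> by (simp add: add_divide_distrib)
  finally show ?thesis .
qed

lemma last_bound:
  assumes "S \<ge> 1"
  shows "expectation (\<lambda>\<omega>. f (y S \<omega>))
    \<le> (\<Sum>i=1..S. expectation (\<lambda>\<omega>. f (y i \<omega>))) / real S + c * G\<^sup>2 / 2 * harm (S - 1)"
proof (rule last_le_average_plus_harm)
  fix m assume m: "m \<in> {1..S}"
  then have "(\<Sum>i=m..S. expectation (\<lambda>\<omega>. f (y i \<omega>)) - expectation (\<lambda>\<omega>. f (y m \<omega>)))
      \<le> (real S + 1 - real m) * (c * G\<^sup>2 / 2)"
    using suffix_bound[of m "y m"] y_adapted y_in_X integrable_f_y by simp
  moreover have "(\<Sum>i=m..S. expectation (\<lambda>\<omega>. f (y i \<omega>)) - expectation (\<lambda>\<omega>. f (y m \<omega>)))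
      = (\<Sum>i=m..S. expectation (\<lambda>\<omega>. f (y i \<omega>)))
        - (real S + 1 - real m) * expectation (\<lambda>\<omega>. f (y m \<omega>))"
    using m by (simp add: sum_subtractf of_nat_diff)
  ultimately show "(\<Sum>i=m..S. expectation (\<lambda>\<omega>. f (y i \<omega>)))
      \<le> (real S + 1 - real m) * (expectation (\<lambda>\<omega>. f (y m \<omega>)) + c * G\<^sup>2 / 2)"
    unfolding distrib_left by linarith
qed fact

end

section \<open>The filtration generated by the oracle answers\<close>

lemma space_sgd_past [simp]: "space (sgd_past M S ghat t i) = space M"
  by (simp add: sgd_past_def space_measure_of_conv)

lemma sets_sgd_past:
  "sets (sgd_past M S ghat t i) = sigma_sets (space M)
     {ghat s j -` A \<inter> space M | s j A.
        A \<in> sets borel \<and> 1 \<le> s \<and> 1 \<le> j \<and> (s < t \<and> j \<le> S \<or> s = t \<and> j < i)}"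
  unfolding sgd_past_def by (intro sets_measure_of) auto

text \<open>Within the current outer iteration the past restricts \<open>j\<close> only by
  \<open>j < i\<close>; the bound \<open>i \<le> S + 1\<close> therefore keeps all generating
  answers among those assumed measurable.\<close>

lemma subalgebra_sgd_past:
  assumes "\<And>s j. s \<in> {1..t} \<Longrightarrow> j \<in> {1..S} \<Longrightarrow> ghat s j \<in> borel_measurable M" and "i \<le> S + 1"
  shows "subalgebra M (sgd_past M S ghat t i)"
  unfolding subalgebra_def sets_sgd_past
proof (intro conjI sets.sigma_sets_subset space_sgd_past subsetI, elim CollectE exE conjE)
  fix B s j A
  assume B: "B = ghat s j -` A \<inter> space M" and A: "A \<in> sets borel"
    and "1 \<le> s" "1 \<le> j" "s < t \<and> j \<le> S \<or> s = t \<and> j < i"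
  then have "s \<in> {1..t}" "j \<in> {1..S}"
    using \<open>i \<le> S + 1\<close> by auto
  from measurable_sets[OF assms(1)[OF this] A] show "B \<in> sets M"
    unfolding B .
qed

text \<open>When the outer index grows, answers with \<open>j < i\<close> must satisfy
  \<open>j \<le> S\<close> to remain generators, which \<open>i \<le> S + 1\<close> ensures.\<close>

lemma sets_sgd_past_mono:
  assumes "t < t' \<and> i \<le> S + 1 \<or> t = t' \<and> i \<le> i'"
  shows "sets (sgd_past M S ghat t i) \<subseteq> sets (sgd_past M S ghat t' i')"
  unfolding sets_sgd_past
proof (intro sigma_sets_mono' subsetI, elim CollectE exE conjE)
  fix B s j A
  assume "B = ghat s j -` A \<inter> space M" and "A \<in> sets borel" and "1 \<le> s" "1 \<le> j"
    and "s < t \<and> j \<le> S \<or> s = t \<and> j < i"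
  moreover from this have "s < t' \<and> j \<le> S \<or> s = t' \<and> j < i'"
    using assms by auto
  ultimately show "B \<in> {ghat s j -` A \<inter> space M | s j A.
      A \<in> sets borel \<and> 1 \<le> s \<and> 1 \<le> j \<and> (s < t' \<and> j \<le> S \<or> s = t' \<and> j < i')}"
    by blast
qed

lemma ghat_measurable_sgd_past:
  fixes ghat :: "nat \<Rightarrow> nat \<Rightarrow> 'w \<Rightarrow> 'a::topological_space"
  assumes "1 \<le> t" and "1 \<le> i"
  shows "ghat t i \<in> borel_measurable (sgd_past M S ghat t (i + 1))"
proof (rule measurableI)
  fix A :: "'a set" assume "A \<in> sets borel"
  with assms show "ghat t i -` A \<inter> space (sgd_past M S ghat t (i + 1))
      \<in> sets (sgd_past M S ghat t (i + 1))"
    unfolding sets_sgd_past space_sgd_past 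
    by (intro sigma_sets.Basic CollectI exI[of _ t] exI[of _ i] exI[of _ A]) auto
qed simp

text \<open>An iterate is a Borel function of the previous iterate and the previous answer. The
  induction on \<open>i\<close> inside one outer iteration is nested in an induction on
  \<open>t\<close>.\<close>

lemma step_decay_sgd_iterate:
  assumes sgd: "step_decay_sgd M X x11 \<eta>0 \<alpha> S N ghat x"
    and X: "closed X" "convex X" "x11 \<in> X"
    and t: "t \<in> {1..N}" and i: "i \<in> {1..S + 1}"
  shows "x t i \<in> borel_measurable (sgd_past M S ghat t i) \<and> (\<forall>\<omega>\<in>space M. x t i \<omega> \<in> X)"
proof -
  have nonempty: "X \<noteq> {}" using X by blast
  let ?P = "\<lambda>t i. x t i \<in> borel_measurable (sgd_past M S ghat t i) \<and> (\<forall>\<omega>\<in>space M. x t i \<omega> \<in> X)"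
  have inner: "?P t i" if t: "t \<in> {1..N}" and "?P t 1" and i: "1 \<le> i" "i \<le> S + 1" for t i
    using i
  proof (induction i rule: dec_induct)
    case base
    then show ?case using that by simp
  next
    case (step i)
    define h where "h \<omega> = closest_point X (x t i \<omega> - (\<eta>0 / \<alpha> ^ (t - 1)) *\<^sub>R ghat t i \<omega>)" for \<omega>
    have eq: "x t (Suc i) \<omega> = h \<omega>" if "\<omega> \<in> space M" for \<omega>
      using sgd t step that unfolding step_decay_sgd_def h_def by simp
    \<comment> \<open>Projection onto a nonempty closed convex set is continuous.\<close>
    have [measurable]: "closest_point X \<in> borel_measurable borel"
      by (intro borel_measurable_continuous_onI continuous_on_closest_point X nonempty)
    have [measurable]: "ghat t i \<in> borel_measurable (sgd_past M S ghat t (Suc i))"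
      using ghat_measurable_sgd_past[of t i] t step by simp
    have "x t i \<in> borel_measurable (sgd_past M S ghat t i)"
      using step by simp
    then have [measurable]: "x t i \<in> borel_measurable (sgd_past M S ghat t (Suc i))"
      using measurable_mono[of borel borel "sgd_past M S ghat t i" "sgd_past M S ghat t (Suc i)"]
        sets_sgd_past_mono[of t t i S "Suc i" M ghat] by auto
    have "h \<in> borel_measurable (sgd_past M S ghat t (Suc i))"
      unfolding h_def by measurable
    then have "x t (Suc i) \<in> borel_measurable (sgd_past M S ghat t (Suc i))"
      \<comment> \<open>The recursion holds only on \<open>space M\<close>, so the iterate is
        replaced by \<open>h\<close> there.\<close>
      by (subst measurable_cong[of _ _ h]) (auto simp: eq)
    moreover have "h \<omega> \<in> X" for \<omega>
      unfolding h_def by (intro closest_point_in_set X nonempty)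
    ultimately show ?case using eq by simp
  qed
  have "?P t 1"
  proof -
    have "1 \<le> t" "t \<le> N" using t by auto
    then show ?thesis
    proof (induction t rule: dec_induct)
      case base
      have eq: "x 1 1 \<omega> = x11" if "\<omega> \<in> space M" for \<omega>
        using sgd that by (simp add: step_decay_sgd_def)
      have "x 1 1 \<in> borel_measurable (sgd_past M S ghat 1 1)"
        by (subst measurable_cong[of _ _ "\<lambda>_. x11"]) (use eq in auto)
      then show ?case using X eq by simp
    next
      case (step t)
      have eq: "x (Suc t) 1 \<omega> = x t (S + 1) \<omega>" if "\<omega> \<in> space M" for \<omega>
        using sgd that step by (simp add: step_decay_sgd_def)
      have *: "?P t (S + 1)"
        using inner[of t "S + 1"] step by simp
      then have "x t (S + 1) \<in> borel_measurable (sgd_past M S ghat (Suc t) 1)"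
        using measurable_mono[of borel borel "sgd_past M S ghat t (S + 1)"
            "sgd_past M S ghat (Suc t) 1"]
          sets_sgd_past_mono[of t "Suc t" "S + 1" S 1 M ghat] by auto
      then have "x (Suc t) 1 \<in> borel_measurable (sgd_past M S ghat (Suc t) 1)"
        by (subst measurable_cong[of _ _ "x t (S + 1)"]) (use eq in auto)
      then show ?case using * eq by simp
    qed
  qed
  from inner[OF t this] show ?thesis using i by simp
qed

section \<open>The last outer iteration and the constants\<close>

theorem theorem4p1:
  fixes M :: "'w measure"
    and X :: "'a::euclidean_space set" and f :: "'a \<Rightarrow> real"
    and x11 :: 'a and ghat x :: "nat \<Rightarrow> nat \<Rightarrow> 'w \<Rightarrow> 'a"
    and D G \<eta>0 \<alpha> A2 B2 fstar :: real and T S N :: nat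
  assumes "prob_space M"
    and "closed X" and "convex X"
    and "\<forall>u\<in>X. \<forall>v\<in>X. (norm (u - v))\<^sup>2 \<le> D\<^sup>2"
    and "convex_on X f" and "bdd_below (f ` X)" and "fstar = (INF u\<in>X. f u)"
    and "G > 0" and "\<eta>0 > 0" and "\<alpha> > 1" and "T > 1"
    and "S \<ge> 1" and "N \<ge> 1"
    and "real S = 2 * real T / log \<alpha> (real T)"
    and "real N = real T / real S"
    and "x11 \<in> X"
    and "step_decay_sgd M X x11 \<eta>0 \<alpha> S N ghat x"
    and "unbiased_subgradient_oracle M X f S N x ghat"
    and "oracle_bounded_by M S N ghat (G\<^sup>2)"
    and "A2 = D\<^sup>2 / (4 * \<eta>0 * \<alpha> * ln \<alpha>)"
    and "B2 = G\<^sup>2 * \<eta>0 * \<alpha> / 2"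
  shows "1 / real S * (\<Sum>i=1..S. prob_space.expectation M (\<lambda>\<omega>. f (x N i \<omega>))) - fstar
           \<le> A2 * (ln (real T) / sqrt (real T)) + B2 / sqrt (real T) \<and>
         prob_space.expectation M (\<lambda>\<omega>. f (x N S \<omega>)) - fstar
           \<le> (A2 + B2) * (ln (real T) / sqrt (real T)) + (2 + ln 2) * B2 / sqrt (real T)"
proof -
  note unbiased = assms(18)[unfolded unbiased_subgradient_oracle_def]
  define c where "c = \<eta>0 / \<alpha> ^ (N - 1)"
  have T_pos: "real T > 1" and lnT: "ln (real T) > 0" using \<open>T > 1\<close> by auto
  have lna: "ln \<alpha> > 0" using \<open>\<alpha> > 1\<close> by simp
  have S_pos: "real S > 0" using \<open>S \<ge> 1\<close> by simp
  have S_eq: "real S = 2 * real T * ln \<alpha> / ln (real T)"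
    using \<open>real S = 2 * real T / log \<alpha> (real T)\<close> by (simp add: log_def)
  \<comment> \<open>This is \<open>N = (log \<alpha> T) / 2\<close> without the quotient;
    exponentiating it gives \<open>\<alpha> ^ N = sqrt T\<close>.\<close>
  have N_ln: "real N * ln \<alpha> = ln (real T) / 2"
    unfolding \<open>real N = real T / real S\<close> S_eq using lna T_pos by simp
  have "\<alpha> ^ N = exp (real N * ln \<alpha>)"
    using \<open>\<alpha> > 1\<close> by (simp add: exp_of_nat_mult)
  also have "\<dots> = sqrt (real T)"
    unfolding N_ln using T_pos by (simp add: powr_half_sqrt[symmetric] powr_def)
  finally have power_N: "\<alpha> ^ N = sqrt (real T)" .
  \<comment> \<open>The exponent in \<open>c\<close> is \<open>N - 1\<close>, hence the extra factor
    \<open>\<alpha>\<close>.\<close>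
  have c_eq: "c = \<eta>0 * \<alpha> / sqrt (real T)"
    using \<open>N \<ge> 1\<close> \<open>\<alpha> > 1\<close> power_N[symmetric] by (simp add: c_def power_eq_if)
  have c_pos: "c > 0" using \<open>\<eta>0 > 0\<close> \<open>\<alpha> > 1\<close> by (simp add: c_def)
  have meas: "ghat s j \<in> borel_measurable M" if "s \<in> {1..N}" "j \<in> {1..S}" for s j
    using unbiased that by (intro borel_measurable_integrable) blast
  text \<open>The index is capped so that beyond \<open>S\<close>, where the oracle answers are unconstrained, the
    filtration stays inside \<open>M\<close>.\<close>
  define F where "F i = sgd_past M S ghat N (min i (S + 1))" for i
  have F_eq: "F i = sgd_past M S ghat N i" if "i \<in> {1..S + 1}" for i
    using that by (simp add: F_def min_def)
  note iterate = step_decay_sgd_iterate[OF assms(17) assms(2,3,16)]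
  interpret prob_space M by fact
  interpret projected_sgd M X f F "x N" "ghat N" c D G S
  \<comment> \<open>Cases 7 to 14 are the assumptions from \<open>F_subalg\<close> to
    \<open>g_bounded\<close>; the first six are discharged by the closing
    \<open>qed\<close>.\<close>
  proof (unfold_locales, goal_cases)
    case (7 i)
    show ?case unfolding F_def by (rule subalgebra_sgd_past) (auto intro: meas)
  next
    case (8 i j)
    then show ?case unfolding F_def by (intro sets_sgd_past_mono) auto
  next
    case (9 i \<omega>)
    then show ?case using iterate[of N i] \<open>N \<ge> 1\<close> by simp
  next
    case (10 i)
    then show ?case using iterate[of N i] \<open>N \<ge> 1\<close> by (simp add: F_eq)
  next
    case (11 i \<omega>)
    then show ?case using assms(17) \<open>N \<ge> 1\<close> by (simp add: step_decay_sgd_def c_def)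
  next
    case (12 i)
    then show ?case using unbiased \<open>N \<ge> 1\<close> by simp
  next
    case (13 i)
    then show ?case using unbiased \<open>N \<ge> 1\<close> by (simp add: F_eq)
  next
    case (14 i)
    then show ?case using assms(19) \<open>N \<ge> 1\<close> by (simp add: oracle_bounded_by_def F_eq)
  qed (fact assms(2) assms(3) assms(6) c_pos conjunct1[OF unbiased] | use assms(4) in simp)+
  let ?avg = "(\<Sum>i=1..S. expectation (\<lambda>\<omega>. f (x N i \<omega>))) / real S"
  \<comment> \<open>The average bound holds against every \<open>u\<close> in \<open>X\<close> and
    so passes to the infimum; no minimizer has to be chosen.\<close>
  have "?avg - D\<^sup>2 / (2 * c * real S) - c * G\<^sup>2 / 2 \<le> fstar"
    unfolding \<open>fstar = (INF u\<in>X. f u)\<close>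
    using \<open>x11 \<in> X\<close> average_bound[OF \<open>S \<ge> 1\<close>] by (intro cINF_greatest) (auto simp: algebra_simps)
  moreover have "D\<^sup>2 / (2 * c * real S) = A2 * (ln (real T) / sqrt (real T))"
  proof -
    have "c * real S = 2 * \<eta>0 * \<alpha> * ln \<alpha> * (real T / sqrt (real T)) / ln (real T)"
      unfolding c_eq S_eq by simp
    also have "real T / sqrt (real T) = sqrt (real T)"
      by (simp add: real_div_sqrt)
    finally have cS: "c * real S = 2 * \<eta>0 * \<alpha> * ln \<alpha> * sqrt (real T) / ln (real T)" .
    show ?thesis
      unfolding mult.assoc[of 2 c] cS \<open>A2 = _\<close> by simp
  qed
  moreover have half_step: "c * G\<^sup>2 / 2 = B2 / sqrt (real T)"
    unfolding c_eq \<open>B2 = _\<close> by (simp add: mult.commute mult.left_commute)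
  ultimately have average: "?avg - fstar \<le> A2 * (ln (real T) / sqrt (real T)) + B2 / sqrt (real T)"
    by linarith
  \<comment> \<open>This lets \<open>ln T\<close> replace the logarithm of \<open>S - 1\<close> from
    the harmonic number.\<close>
  have "real S \<le> real T"
  proof -
    have "real T = real N * real S"
      using \<open>real N = real T / real S\<close> S_pos by simp
    then show ?thesis using mult_right_mono[of 1 "real N" "real S"] \<open>N \<ge> 1\<close> by simp
  qed
  then have harm: "harm (S - 1) \<le> 1 + ln (real T)"
  proof (cases "S = 1")
    case False
    then have "harm (S - 1) \<le> 1 + ln (real (S - 1))"
      using \<open>S \<ge> 1\<close> by (intro harm_le_one_plus_ln) simp
    also have "\<dots> \<le> 1 + ln (real T)"
      using False \<open>S \<ge> 1\<close> \<open>real S \<le> real T\<close> by simp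
    finally show ?thesis .
  qed (use lnT in \<open>simp add: harm_expand\<close>)
  have B2_pos: "B2 / sqrt (real T) \<ge> 0"
    unfolding half_step[symmetric] using c_pos by simp
  \<comment> \<open>One \<open>B2 / sqrt T\<close> comes from the average and another from the 1 in
    the harmonic bound, whose logarithm adds \<open>B2\<close> to \<open>A2\<close>.\<close>
  have "expectation (\<lambda>\<omega>. f (x N S \<omega>)) - fstar
      \<le> A2 * (ln (real T) / sqrt (real T)) + B2 / sqrt (real T)
        + B2 / sqrt (real T) * (1 + ln (real T))"
    using last_bound[OF \<open>S \<ge> 1\<close>, unfolded half_step] average mult_left_mono[OF harm B2_pos] by linarith
  \<comment> \<open>A nonnegative term is added to turn the constant 2 into the stated
    \<open>2 + ln 2\<close>.\<close>
  also have "\<dots> \<le> \<dots> + ln 2 * (B2 / sqrt (real T))"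
    using mult_nonneg_nonneg[OF _ B2_pos, of "ln 2"] by simp
  also have "\<dots> = (A2 + B2) * (ln (real T) / sqrt (real T)) + (2 + ln 2) * B2 / sqrt (real T)"
    by (simp add: add_divide_distrib algebra_simps)
  finally have "expectation (\<lambda>\<omega>. f (x N S \<omega>)) - fstar
      \<le> (A2 + B2) * (ln (real T) / sqrt (real T)) + (2 + ln 2) * B2 / sqrt (real T)" .
  moreover have "1 / real S * (\<Sum>i=1..S. expectation (\<lambda>\<omega>. f (x N i \<omega>))) = ?avg"
    by (simp only: times_divide_eq_left mult_1_left)
  ultimately show ?thesis
    using average by (simp only: simp_thms)
qed

end
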